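(* Let $\mathcal{H}$ be a complex Hilbert space and let $T$ be a bounded linear operator on $\mathcal{H}$ with mean transform $\widehat{T}$. Then $$\overline{W(\widehat{T})}\subseteq \overline{W(T)},$$ where $\overline{W(T)}$ denotes the closure of the numerical range $W(T)$ of $T$. In particular, $w(\widehat{T})\leq w(T)$.
   Context: For a bounded operator $T$, $|T|:=(T^*T)^{1/2}$, and the canonical polar decomposition is $T=V|T|$ where $V$ is the partial isometry with null space $\mathcal{N}(V)=\mathcal{N}(T)$. The mean transform of $T$ is $\widehat{T}:=\frac12(V|T|+|T|V)$, where $T=V|T|$ is the canonical polar decomposition. The numerical range is $W(T):=\{\langle Tx,x\rangle : x\in\mathcal{H},\ \|x\|=1\}$ and the numerical radius is $w(T):=\sup\{|\lambda| : \lambda\in W(T)\}$. *)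

theory Defs
  imports "HOL-Analysis.Analysis"
begin

class complex_vector = real_vector +
  fixes scaleC :: "complex \<Rightarrow> 'a \<Rightarrow> 'a" (infixr \<open>*\<^sub>C\<close> 75)
  assumes scaleC_add_right: "c *\<^sub>C (x + y) = c *\<^sub>C x + c *\<^sub>C y"
    and scaleC_add_left: "(c + d) *\<^sub>C x = c *\<^sub>C x + d *\<^sub>C x"
    and scaleC_scaleC: "c *\<^sub>C d *\<^sub>C x = (c * d) *\<^sub>C x"
    and scaleC_of_real: "complex_of_real r *\<^sub>C x = r *\<^sub>R x"

text \<open>The complex inner product is linear in its first argument. Its real part is the inner
  product of the underlying real space, so positive definiteness, the norm and the topology are
  those of \<^class>\<open>real_inner\<close>; see \<open>cinner_self\<close> below.\<close>

class complex_inner = complex_vector + real_inner +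
  fixes cinner :: "'a \<Rightarrow> 'a \<Rightarrow> complex"
  assumes cinner_commute: "cinner x y = cnj (cinner y x)"
    and cinner_add_left: "cinner (x + y) z = cinner x z + cinner y z"
    and cinner_scaleC_left: "cinner (c *\<^sub>C x) y = c * cinner x y"
    and inner_eq_Re_cinner: "inner x y = Re (cinner x y)"

class complex_hilbert_space = complex_inner + complete_space

lemma cinner_self: "cinner x x = complex_of_real ((norm x)\<^sup>2)"
proof (rule complex_eqI)
  show "Re (cinner x x) = Re (complex_of_real ((norm x)\<^sup>2))"
    by (simp add: inner_eq_Re_cinner[symmetric] power2_norm_eq_inner)
  have "Im (cinner x x) = - Im (cinner x x)"
    using arg_cong[OF cinner_commute[of x x], of Im] by simp
  then show "Im (cinner x x) = Im (complex_of_real ((norm x)\<^sup>2))"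
    by simp
qed

definition bounded_clinear :: "('a::complex_inner \<Rightarrow> 'b::complex_inner) \<Rightarrow> bool" where
  "bounded_clinear T \<longleftrightarrow> bounded_linear T \<and> (\<forall>c x. T (c *\<^sub>C x) = c *\<^sub>C T x)"

definition adj :: "('a::complex_inner \<Rightarrow> 'b::complex_inner) \<Rightarrow> 'b \<Rightarrow> 'a" where
  "adj T = (THE S. \<forall>x y. cinner (T x) y = cinner x (S y))"

definition positive_op :: "('a::complex_inner \<Rightarrow> 'a) \<Rightarrow> bool" where
  "positive_op A \<longleftrightarrow> bounded_clinear A \<and> (\<forall>x. cinner (A x) x \<in> \<real>\<^sub>\<ge>\<^sub>0)"

definition op_sqrt :: "('a::complex_inner \<Rightarrow> 'a) \<Rightarrow> 'a \<Rightarrow> 'a" where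
  "op_sqrt A = (THE P. positive_op P \<and> P \<circ> P = A)"

definition op_abs :: "('a::complex_inner \<Rightarrow> 'a) \<Rightarrow> 'a \<Rightarrow> 'a" where
  "op_abs T = op_sqrt (adj T \<circ> T)"

definition null_space :: "('a::complex_inner \<Rightarrow> 'b::complex_inner) \<Rightarrow> 'a set" where
  "null_space T = {x. T x = 0}"

text \<open>A partial isometry is isometric on the orthogonal complement of its null space.\<close>

definition partial_isometry :: "('a::complex_inner \<Rightarrow> 'b::complex_inner) \<Rightarrow> bool" where
  "partial_isometry V \<longleftrightarrow> bounded_clinear V \<and>
     (\<forall>x. (\<forall>y\<in>null_space V. cinner x y = 0) \<longrightarrow> norm (V x) = norm x)"

definition polar_factor :: "('a::complex_inner \<Rightarrow> 'a) \<Rightarrow> 'a \<Rightarrow> 'a" where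
  "polar_factor T =
     (THE V. partial_isometry V \<and> null_space V = null_space T \<and> T = V \<circ> op_abs T)"

definition mean_transform :: "('a::complex_inner \<Rightarrow> 'a) \<Rightarrow> 'a \<Rightarrow> 'a" where
  "mean_transform T =
     (\<lambda>x. (1/2) *\<^sub>R (polar_factor T (op_abs T x) + op_abs T (polar_factor T x)))"

definition numerical_range :: "('a::complex_inner \<Rightarrow> 'a) \<Rightarrow> complex set" where
  "numerical_range T = {cinner (T x) x | x. norm x = 1}"

text \<open>If the space is zero, the numerical range of every operator is empty and
  \<open>numerical_radius\<close> is the unspecified real \<open>Sup {}\<close>, the same for all operators.\<close>

definition numerical_radius :: "('a::complex_inner \<Rightarrow> 'a) \<Rightarrow> real" where
  "numerical_radius T = (SUP z\<in>numerical_range T. cmod z)"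

end

theory Submission
  imports Defs
begin

text \<open>Let \<open>T = V A\<close> be the polar decomposition, \<open>A = |T|\<close>. Since \<open>V\<^sup>* V A = A\<close>, the Duggal transform
  \<open>A V\<close> equals \<open>V\<^sup>* T V\<close>, so for a unit vector \<open>x\<close> the number \<open>\<langle>mean_transform T x, x\<rangle>\<close> is the average
  of \<open>\<langle>T x, x\<rangle>\<close> and \<open>\<langle>T (V x), V x\<rangle>\<close>. If \<open>T\<close> is injective then \<open>V x\<close> is again a unit vector;
  otherwise \<open>0\<close> lies in the numerical range and \<open>V x\<close> has norm at most \<open>1\<close>. In both cases convexity
  of the numerical range (Toeplitz-Hausdorff) gives the inclusion, even before taking closures.\<close>

section \<open>Complex inner products\<close>

text \<open>\<open>op_abs\<close> and \<open>polar_factor\<close> are definite descriptions, so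
  nothing is known about them before existence and uniqueness are settled; adjoints, positive square
  roots and polar factors are therefore constructed from completeness. The adjoint of the polar
  factor \<open>V\<close> is never formed: \<open>V\<^sup>* V A = A\<close> enters only as an
  identity between inner products. The case split on injectivity is what avoids limits: the value of
  the form at a nonzero \<open>V x\<close> is the square of \<open>norm (V x)\<close> times a point
  of the numerical range, and convexity brings such a shrunken point back into the range as soon as
  0 lies there, which a kernel vector guarantees. Norm and topology come from the real inner
  product, so projection and representation arguments are real; the complex structure is recovered
  by multiplying with a phase or with \<i>.\<close>

lemma norm_scaleC: "norm (c *\<^sub>C x) = cmod c * norm x"
  for x :: "'a::complex_inner"
proof -
  have "complex_of_real ((norm (c *\<^sub>C x))\<^sup>2) = c * cnj (c * cinner x x)"
    by (metis cinner_self cinner_commute cinner_scaleC_left)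
  also have "\<dots> = complex_of_real ((cmod c * norm x)\<^sup>2)"
    by (simp add: cinner_self power_mult_distrib complex_norm_square[symmetric] flip: mult.assoc)
  finally have "(norm (c *\<^sub>C x))\<^sup>2 = (cmod c * norm x)\<^sup>2"
    using of_real_eq_iff by blast
  then show ?thesis
    by (simp add: power2_eq_iff_nonneg)
qed

lemma cinner_add_right: "cinner x (y + z) = cinner x y + cinner x z"
  by (metis cinner_add_left cinner_commute complex_cnj_add)

lemma cinner_scaleC_right: "cinner x (c *\<^sub>C y) = cnj c * cinner x y"
  by (metis cinner_commute cinner_scaleC_left complex_cnj_mult)

lemma cinner_scaleR_left: "cinner (r *\<^sub>R x) y = r *\<^sub>R cinner x y"
  by (metis cinner_scaleC_left scaleC_of_real scaleR_conv_of_real)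

lemma cinner_scaleR_right: "cinner x (r *\<^sub>R y) = r *\<^sub>R cinner x y"
  by (metis cinner_scaleC_right complex_cnj_complex_of_real scaleC_of_real scaleR_conv_of_real)

lemma cmod_cinner_le: "cmod (cinner x y) \<le> norm x * norm y"
proof (cases "cinner x y = 0")
  case False
  \<comment> \<open>The phase \<open>c\<close> rotates the inner product to its modulus, so the real
    Cauchy-Schwarz inequality applies to \<open>c *\<^sub>C x\<close> and \<open>y\<close>.\<close>
  define c where "c = cnj (sgn (cinner x y))"
  have "c * cinner x y = complex_of_real (cmod (cinner x y))"
    unfolding c_def sgn_eq using False
    by (simp add: mult.commute complex_norm_square[symmetric] power2_eq_square)
  then have "cmod (cinner x y) = inner (c *\<^sub>C x) y"
    by (simp add: inner_eq_Re_cinner cinner_scaleC_left)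
  also have "\<dots> \<le> norm (c *\<^sub>C x) * norm y"
    by (rule norm_cauchy_schwarz)
  also have "\<dots> = norm x * norm y"
    using False by (simp add: norm_scaleC c_def norm_sgn)
  finally show ?thesis .
qed simp

lemma bounded_bilinear_cinner:
  "bounded_bilinear (cinner :: 'a::complex_inner \<Rightarrow> 'a \<Rightarrow> complex)"
  by standard (auto simp: cinner_add_left cinner_add_right cinner_scaleR_left cinner_scaleR_right
      intro!: exI[of _ 1] cmod_cinner_le)

lemmas cinner_simps =
  cinner_add_left cinner_add_right cinner_scaleC_left cinner_scaleC_right
  cinner_scaleR_left cinner_scaleR_right
  bounded_bilinear.diff_left[OF bounded_bilinear_cinner]
  bounded_bilinear.diff_right[OF bounded_bilinear_cinner]
  bounded_bilinear.zero_left[OF bounded_bilinear_cinner]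
  bounded_bilinear.zero_right[OF bounded_bilinear_cinner]

lemmas tendsto_cinner = bounded_bilinear.tendsto[OF bounded_bilinear_cinner]

lemma Re_cinner_self: "Re (cinner x x) = (norm x)\<^sup>2"
  by (simp add: cinner_self)

lemma cinner_eqI:
  assumes "\<And>z. cinner z x = cinner z y"
  shows "x = y"
proof -
  have "cinner (x - y) (x - y) = 0"
    using assms[of "x - y"] by (simp add: cinner_simps)
  then show ?thesis
    by (simp add: cinner_self)
qed

section \<open>Algebra of bounded complex-linear maps\<close>

lemma bounded_linear_scaleC: "bounded_linear (\<lambda>x::'a::complex_inner. c *\<^sub>C x)"
proof (rule bounded_linear_intro)
  fix r and x :: 'a
  show "c *\<^sub>C (r *\<^sub>R x) = r *\<^sub>R (c *\<^sub>C x)"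
    by (metis scaleC_of_real scaleC_scaleC mult.commute)
  show "norm (c *\<^sub>C x) \<le> norm x * cmod c"
    by (simp add: norm_scaleC)
qed (rule scaleC_add_right)

lemma bounded_clinear_linear: "bounded_clinear T \<Longrightarrow> bounded_linear T"
  by (simp add: bounded_clinear_def)

lemma bounded_clinear_scaleC: "bounded_clinear T \<Longrightarrow> T (c *\<^sub>C x) = c *\<^sub>C T x"
  by (simp add: bounded_clinear_def)

lemma bounded_clinear_compose:
  "bounded_clinear S \<Longrightarrow> bounded_clinear T \<Longrightarrow> bounded_clinear (\<lambda>x. S (T x))"
  by (simp add: bounded_clinear_def bounded_linear_compose)

lemma bounded_clinear_add:
  "bounded_clinear S \<Longrightarrow> bounded_clinear T \<Longrightarrow> bounded_clinear (\<lambda>x. S x + T x)"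
  by (simp add: bounded_clinear_def bounded_linear_add scaleC_add_right)

lemma bounded_clinear_ident: "bounded_clinear (\<lambda>x. x)"
  by (simp add: bounded_clinear_def bounded_linear_ident)

lemma bounded_clinear_zero: "bounded_clinear (\<lambda>x. 0)"
  using linear_0[OF bounded_linear.linear[OF bounded_linear_scaleC]]
  by (auto simp: bounded_clinear_def bounded_linear_zero)

lemma bounded_clinear_scaleR:
  assumes "bounded_clinear T"
  shows "bounded_clinear (\<lambda>x. r *\<^sub>R T x)"
  using assms
  by (simp add: bounded_clinear_def bounded_linear_const_scaleR
      linear_scale[OF bounded_linear.linear[OF bounded_linear_scaleC]])

lemma bounded_clinear_diff:
  assumes "bounded_clinear S" "bounded_clinear T"
  shows "bounded_clinear (\<lambda>x. S x - T x)"
  using bounded_clinear_add[OF assms(1) bounded_clinear_scaleR[OF assms(2), of "-1"]] by simp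

section \<open>Orthogonal projection and adjoints\<close>

lemma parallelogram: "(norm (x + y))\<^sup>2 + (norm (x - y))\<^sup>2 = 2 * (norm x)\<^sup>2 + 2 * (norm y)\<^sup>2"
  for x y :: "'a::real_inner"
  by (simp add: power2_norm_eq_inner inner_simps)

text \<open>A sequence in \<open>S\<close> minimising the squared distance to \<open>x\<close> is
  Cauchy by the parallelogram law; its limit is a nearest point, and minimality forces
  orthogonality.\<close>

lemma orthogonal_projection_exists:
  fixes S :: "'a::{real_inner,complete_space} set"
  assumes "closed S" "subspace S"
  obtains p where "p \<in> S" "\<And>y. y \<in> S \<Longrightarrow> inner (x - p) y = 0"
proof -
  define D where "D = (INF y\<in>S. (norm (x - y))\<^sup>2)"
  have bdd: "bdd_below ((\<lambda>y. (norm (x - y))\<^sup>2) ` S)"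
    by (rule bdd_belowI[of _ 0]) auto
  have ne: "S \<noteq> {}"
    using subspace_0[OF assms(2)] by auto
  have D_le: "D \<le> (norm (x - y))\<^sup>2" if "y \<in> S" for y
    unfolding D_def using bdd that by (rule cINF_lower)
  have "\<exists>y\<in>S. (norm (x - y))\<^sup>2 < D + inverse (real (Suc n))" for n
    using cINF_less_iff[OF ne bdd, of "D + inverse (real (Suc n))"]
    by (simp add: D_def)
  then obtain p where p: "\<And>n. p n \<in> S" "\<And>n. (norm (x - p n))\<^sup>2 < D + inverse (real (Suc n))"
    by metis
  have dist: "(norm (p m - p n))\<^sup>2 \<le> 2 * inverse (real (Suc m)) + 2 * inverse (real (Suc n))" for m n
  proof -
    \<comment> \<open>The midpoint stays in \<open>S\<close>, so its squared distance to
      \<open>x\<close> is at least \<open>D\<close>; this makes the other diagonal of the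
      parallelogram small.\<close>
    have "(1/2) *\<^sub>R (p m + p n) \<in> S"
      using assms(2) p(1) by (simp add: subspace_add subspace_scale)
    then have "4 * D \<le> (2 * norm (x - (1/2) *\<^sub>R (p m + p n)))\<^sup>2"
      using D_le by (simp add: power_mult_distrib)
    also have "2 * norm (x - (1/2) *\<^sub>R (p m + p n)) = norm (2 *\<^sub>R (x - (1/2) *\<^sub>R (p m + p n)))"
      by simp
    also have "2 *\<^sub>R (x - (1/2) *\<^sub>R (p m + p n)) = (x - p m) + (x - p n)"
      by (simp add: algebra_simps scaleR_2)
    finally have "4 * D \<le> (norm ((x - p m) + (x - p n)))\<^sup>2" .
    then show ?thesis
      using parallelogram[of "x - p m" "x - p n"] p(2)[of m] p(2)[of n]
      by (simp add: norm_minus_commute)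
  qed
  have "Cauchy p"
  proof (rule CauchyI)
    fix e :: real assume "e > 0"
    then obtain M where M: "inverse (real (Suc M)) < e\<^sup>2 / 4"
      using reals_Archimedean[of "e\<^sup>2 / 4"] by auto
    have "norm (p m - p n) < e" if "m \<ge> M" "n \<ge> M" for m n
    proof -
      have "inverse (real (Suc m)) \<le> inverse (real (Suc M))"
        "inverse (real (Suc n)) \<le> inverse (real (Suc M))"
        using that by (auto intro!: le_imp_inverse_le)
      then have "(norm (p m - p n))\<^sup>2 < e\<^sup>2"
        using dist[of m n] M by linarith
      then show ?thesis
        using \<open>e > 0\<close> by (simp add: power_less_imp_less_base)
    qed
    then show "\<exists>M. \<forall>m\<ge>M. \<forall>n\<ge>M. norm (p m - p n) < e"
      by blast
  qed
  then obtain q where q: "p \<longlonglongrightarrow> q"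
    by (meson Cauchy_convergent convergentD)
  have qS: "q \<in> S"
    using assms(1) p(1) q closed_sequentially by blast
  have "(\<lambda>n. (norm (x - p n))\<^sup>2) \<longlonglongrightarrow> (norm (x - q))\<^sup>2"
    by (intro tendsto_intros q)
  moreover have "(\<lambda>n. D + inverse (real (Suc n))) \<longlonglongrightarrow> D + 0"
    by (intro tendsto_intros LIMSEQ_inverse_real_of_nat)
  ultimately have "(norm (x - q))\<^sup>2 \<le> D + 0"
    by (rule LIMSEQ_le) (use p(2) less_imp_le in blast)
  then have q_le: "(norm (x - q))\<^sup>2 \<le> D"
    by simp
  have "inner (x - q) y = 0" if "y \<in> S" for y
  proof (cases "y = 0")
    case False
    \<comment> \<open>The coefficient of \<open>y\<close> in the projection of \<open>x - q\<close>
      onto the line of \<open>y\<close>: moving \<open>q\<close> by \<open>t *\<^sub>R y\<close>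
      would shorten the distance unless \<open>t\<close> vanishes.\<close>
    define t where "t = inner (x - q) y / inner y y"
    have "q + t *\<^sub>R y \<in> S"
      using assms(2) qS that by (simp add: subspace_add subspace_scale)
    then have "(norm (x - q))\<^sup>2 \<le> (norm ((x - q) - t *\<^sub>R y))\<^sup>2"
      using order_trans[OF q_le D_le] by (simp only: diff_diff_eq)
    also have "\<dots> = (norm (x - q))\<^sup>2 - 2 * t * inner (x - q) y + t\<^sup>2 * inner y y"
      unfolding power2_norm_eq_inner
      by (simp add: inner_diff_left inner_diff_right inner_commute power2_eq_square algebra_simps)
    also have "t\<^sup>2 * inner y y = t * inner (x - q) y"
      using False by (simp add: t_def power2_eq_square)
    finally have "(inner (x - q) y)\<^sup>2 / inner y y \<le> 0"
      by (simp add: t_def power2_eq_square)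
    moreover have "0 < inner y y"
      using False by simp
    ultimately have "(inner (x - q) y)\<^sup>2 \<le> 0"
      by (simp only: pos_divide_le_eq mult_zero_left)
    then show ?thesis by simp
  qed simp
  with qS that show thesis by blast
qed

lemma riesz_representation:
  fixes f :: "'a::{real_inner,complete_space} \<Rightarrow> real"
  assumes "bounded_linear f"
  obtains z where "\<And>x. f x = inner x z"
proof (cases "\<forall>x. f x = 0")
  case True
  with that[of 0] show thesis by simp
next
  case False
  then obtain u where u: "f u \<noteq> 0" by auto
  interpret f: bounded_linear f by fact
  define S where "S = {x. f x = 0}"
  have "closed S"
    unfolding S_def by (intro closed_Collect_eq continuous_intros f.continuous_on)
  moreover have "subspace S"
    by (simp add: S_def subspace_def f.zero f.add f.scaleR)
  ultimately obtain p where p: "p \<in> S" "\<And>y. y \<in> S \<Longrightarrow> inner (u - p) y = 0"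
    by (rule orthogonal_projection_exists[where x = u]) blast
  define w where "w = u - p"
  have fw: "f w \<noteq> 0"
    using u p(1) by (simp add: w_def f.diff S_def)
  then have w0: "inner w w \<noteq> 0"
    using f.zero by auto
  show thesis
  \<comment> \<open>The vector \<open>w\<close> spans the orthogonal complement of the kernel of
    \<open>f\<close>; the factor is forced by testing at \<open>w\<close>.\<close>
  proof (rule that[of "(f w / inner w w) *\<^sub>R w"])
    fix x
    have "x - (f x / f w) *\<^sub>R w \<in> S"
      using fw by (simp add: S_def f.diff f.scaleR)
    then have "inner w x = (f x / f w) * inner w w"
      using p(2) unfolding w_def[symmetric] by (fastforce simp: inner_diff_right)
    then show "f x = inner x ((f w / inner w w) *\<^sub>R w)"
      using fw w0 by (simp add: inner_commute field_simps)
  qed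
qed

lemma cinner_adj:
  fixes T :: "'a::complex_hilbert_space \<Rightarrow> 'b::complex_inner"
  assumes "bounded_clinear T"
  shows "cinner (T x) y = cinner x (adj T y)"
proof -
  have "\<exists>z. \<forall>x. cinner (T x) y = cinner x z" for y
  proof -
    have "bounded_linear (\<lambda>x. Re (cinner (T x) y))"
      by (rule bounded_linear_compose[OF bounded_linear_Re, OF bounded_linear_compose[OF
            bounded_bilinear.bounded_linear_left[OF bounded_bilinear_cinner]
            bounded_clinear_linear[OF assms]]])
    then obtain z where z: "\<And>x. Re (cinner (T x) y) = inner x z"
      by (rule riesz_representation) blast
    have "cinner (T x) y = cinner x z" for x
    proof (rule complex_eqI)
      show "Re (cinner (T x) y) = Re (cinner x z)"
        by (simp add: z inner_eq_Re_cinner)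
      \<comment> \<open>The real representation only matches real parts. Since the real part of \<i>
        times a number is minus its imaginary part, evaluating at \<open>\<i> *\<^sub>C x\<close>
        matches the rest.\<close>
      show "Im (cinner (T x) y) = Im (cinner x z)"
        using z[of "\<i> *\<^sub>C x"]
        by (simp add: inner_eq_Re_cinner bounded_clinear_scaleC[OF assms] cinner_simps)
    qed
    then show ?thesis by blast
  qed
  then obtain S where S: "\<forall>x y. cinner (T x) y = cinner x (S y)"
    by metis
  have "\<exists>!S. \<forall>x y. cinner (T x) y = cinner x (S y)"
    using S by (intro ex1I[of _ S] ext cinner_eqI) auto
  from theI'[OF this] show ?thesis
    unfolding adj_def by blast
qed

lemma bounded_clinear_adj:
  fixes T :: "'a::complex_hilbert_space \<Rightarrow> 'b::complex_inner"
  assumes "bounded_clinear T"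
  shows "bounded_clinear (adj T)"
proof -
  note adj = cinner_adj[OF assms, symmetric]
  obtain K where K: "K > 0" "\<And>x. norm (T x) \<le> norm x * K"
    using bounded_linear.pos_bounded[OF bounded_clinear_linear[OF assms]] by blast
  have bound: "norm (adj T y) \<le> norm y * K" for y
  proof (cases "adj T y = 0")
    case False
    \<comment> \<open>Testing the adjoint relation at \<open>adj T y\<close> itself produces its
      squared norm, and one factor cancels at the end.\<close>
    have "norm (adj T y) * norm (adj T y) = cmod (cinner (T (adj T y)) y)"
      by (simp add: cinner_adj[OF assms] cinner_self power2_eq_square norm_mult)
    also have "\<dots> \<le> norm (adj T y) * K * norm y"
      using cmod_cinner_le K(2)[of "adj T y"] by (meson mult_right_mono norm_ge_zero order_trans)
    finally show ?thesis
      using False by (simp add: mult.assoc mult.commute)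
  qed (use K in simp)
  have "bounded_linear (adj T)"
    by (rule bounded_linear_intro[OF _ _ bound]; rule cinner_eqI; simp add: adj cinner_simps)
  moreover have "adj T (c *\<^sub>C x) = c *\<^sub>C adj T x" for c x
    by (rule cinner_eqI) (simp add: adj cinner_simps)
  ultimately show ?thesis
    by (simp add: bounded_clinear_def)
qed

section \<open>Square roots of positive operators\<close>

lemma cinner_symmetric:
  assumes T: "bounded_clinear T" and real: "\<And>x. cinner (T x) x \<in> \<real>"
  shows "cinner (T x) y = cinner x (T y)"
proof -
  interpret T: bounded_linear T
    using T by (rule bounded_clinear_linear)
  define h where "h x y = cinner (T x) y - cinner x (T y)" for x y
  have diag: "h x x = 0" for x
    using real[of x] cinner_commute[of x "T x"] by (simp add: h_def Reals_cnj_iff)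
  \<comment> \<open>Polarization of the sesquilinear form \<open>h\<close>, which vanishes on the
    diagonal: \<open>x + y\<close> makes it antisymmetric, \<open>x + \<i> *\<^sub>C y\<close> makes
    it symmetric, hence zero.\<close>
  have "h x y + h y x = h (x + y) (x + y) - h x x - h y y"
    by (simp add: h_def T.add cinner_simps)
  moreover have "\<i> * h y x - \<i> * h x y = h (x + \<i> *\<^sub>C y) (x + \<i> *\<^sub>C y) - h x x - h y y"
    by (simp add: h_def T.add bounded_clinear_scaleC[OF T] cinner_simps algebra_simps)
  ultimately have "h x y + h y x = 0" "h y x = h x y"
    by (simp_all add: diag)
  then show ?thesis
    by (simp add: h_def)
qed

lemma positive_op_iff:
  "positive_op P \<longleftrightarrow> bounded_clinear P \<and> (\<forall>x y. cinner (P x) y = cinner x (P y)) \<and>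
     (\<forall>x. 0 \<le> inner (P x) x)" (is "_ \<longleftrightarrow> ?rhs")
proof
  assume P: "positive_op P"
  then have "cinner (P x) x \<in> \<real>" "0 \<le> inner (P x) x" for x
    by (auto simp: positive_op_def complex_nonneg_Reals_iff complex_is_Real_iff inner_eq_Re_cinner)
  with P show ?rhs
    using cinner_symmetric[of P] by (auto simp: positive_op_def)
next
  assume P: ?rhs
  have "Im (cinner (P x) x) = 0" for x
  proof -
    have "cnj (cinner (P x) x) = cinner (P x) x"
      using P by (metis cinner_commute)
    then show ?thesis
      by (metis Reals_cnj_iff complex_is_Real_iff)
  qed
  with P show "positive_op P"
    by (auto simp: positive_op_def complex_nonneg_Reals_iff inner_eq_Re_cinner)
qed

lemma positive_op_bounded_clinear: "positive_op P \<Longrightarrow> bounded_clinear P"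
  by (simp add: positive_op_def)

lemma positive_op_symmetric: "positive_op P \<Longrightarrow> cinner (P x) y = cinner x (P y)"
  by (simp add: positive_op_iff)

lemma positive_op_nonneg: "positive_op P \<Longrightarrow> 0 \<le> inner (P x) x"
  by (simp add: positive_op_iff)

lemma positive_op_scaleR:
  assumes "positive_op P" "0 \<le> r"
  shows "positive_op (\<lambda>x. r *\<^sub>R P x)"
  using assms by (simp add: positive_op_iff bounded_clinear_scaleR cinner_simps)

text \<open>The operator inequality \<open>P\<^sup>2 \<le> K P\<close>. No square root of
  \<open>P\<close> is available yet, so positivity is tested at \<open>K *\<^sub>R x - P x\<close>,
  and Cauchy-Schwarz absorbs the cubic term.\<close>

lemma positive_op_norm_sq_le:
  assumes P: "positive_op P" and K: "0 < K" "\<And>x. norm (P x) \<le> K * norm x"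
  shows "(norm (P x))\<^sup>2 \<le> K * inner (P x) x"
proof -
  interpret P: bounded_linear P
    using P by (intro bounded_clinear_linear positive_op_bounded_clinear)
  have sym: "inner (P (P x)) x = inner (P x) (P x)"
    by (simp add: inner_eq_Re_cinner positive_op_symmetric[OF P])
  have "inner (P (P x)) (P x) \<le> norm (P (P x)) * norm (P x)"
    by (rule norm_cauchy_schwarz)
  also have "\<dots> \<le> K * (norm (P x))\<^sup>2"
    using K(2)[of "P x"] by (simp add: power2_eq_square mult_right_mono flip: mult.assoc)
  finally have PP: "inner (P (P x)) (P x) \<le> K * (norm (P x))\<^sup>2" .
  have "0 \<le> inner (P (K *\<^sub>R x - P x)) (K *\<^sub>R x - P x)"
    by (rule positive_op_nonneg[OF P])
  also have "\<dots> = K\<^sup>2 * inner (P x) x - 2 * K * inner (P x) (P x) + inner (P (P x)) (P x)"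
    by (simp add: P.diff P.scaleR inner_diff_left inner_diff_right sym power2_eq_square algebra_simps)
  also have "inner (P x) (P x) = (norm (P x))\<^sup>2"
    by (rule power2_norm_eq_inner[symmetric])
  also have "K\<^sup>2 * inner (P x) x - 2 * K * (norm (P x))\<^sup>2 + inner (P (P x)) (P x)
      \<le> K * (K * inner (P x) x - (norm (P x))\<^sup>2)"
    using PP by (simp add: power2_eq_square algebra_simps)
  finally show ?thesis
    using K(1) by (simp add: zero_le_mult_iff)
qed

lemma positive_op_eq_0:
  assumes P: "positive_op P" and "inner (P x) x = 0"
  shows "P x = 0"
proof -
  obtain K where "K > 0" "\<And>x. norm (P x) \<le> K * norm x"
    using bounded_linear.pos_bounded[OF bounded_clinear_linear[OF positive_op_bounded_clinear[OF P]]]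
    by (metis mult.commute)
  from positive_op_norm_sq_le[OF P this, of x] assms(2) show ?thesis
    by simp
qed

text \<open>The operators \<open>sqrt_iter B n\<close> converge to a solution of \<open>2 Y = B + Y\<^sup>2\<close>, that is, to
  \<open>Y = 1 - sqrt (1 - B)\<close>. For a contraction \<open>B\<close> the increments are dominated by those of the
  scalar iteration with \<open>B = 1\<close>, which increases to \<open>1\<close>; so no spectral gap is needed.\<close>

primrec sqrt_iter :: "('a::real_vector \<Rightarrow> 'a) \<Rightarrow> nat \<Rightarrow> 'a \<Rightarrow> 'a" where
  "sqrt_iter B 0 = (\<lambda>x. 0)"
| "sqrt_iter B (Suc n) = (\<lambda>x. (1/2) *\<^sub>R (B x + sqrt_iter B n (sqrt_iter B n x)))"

primrec sqrt_iter_bound :: "nat \<Rightarrow> real" where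
  "sqrt_iter_bound 0 = 0"
| "sqrt_iter_bound (Suc n) = (1 + (sqrt_iter_bound n)\<^sup>2) / 2"

section \<open>Domination by the scalar iteration, and convergence\<close>

lemma sqrt_iter_bound_bounds: "0 \<le> sqrt_iter_bound n" "sqrt_iter_bound n \<le> 1"
  by (induction n) (auto simp: power_le_one)

lemma sqrt_iter_bound_le_Suc: "sqrt_iter_bound n \<le> sqrt_iter_bound (Suc n)"
  using sum_squares_bound[of "sqrt_iter_bound n" 1] by simp

lemma incseq_sqrt_iter_bound: "incseq sqrt_iter_bound"
  by (rule incseq_SucI) (rule sqrt_iter_bound_le_Suc)

lemma Cauchy_sqrt_iter_bound: "Cauchy sqrt_iter_bound"
  using incseq_sqrt_iter_bound sqrt_iter_bound_bounds(2)
  by (auto intro: incseq_convergent[of _ 1] LIMSEQ_imp_Cauchy)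

lemma bounded_clinear_sqrt_iter:
  "bounded_clinear B \<Longrightarrow> bounded_clinear (sqrt_iter B n)"
  by (induction n) (simp_all add: bounded_clinear_zero bounded_clinear_scaleR bounded_clinear_add
      bounded_clinear_compose del: scaleR_add_right)

lemma norm_sqrt_iter_le:
  assumes "\<And>x. norm (B x) \<le> norm x"
  shows "norm (sqrt_iter B n x) \<le> sqrt_iter_bound n * norm x"
proof (induction n arbitrary: x)
  case (Suc n)
  have "norm (sqrt_iter B n (sqrt_iter B n x)) \<le> sqrt_iter_bound n * norm (sqrt_iter B n x)"
    by (rule Suc)
  also have "\<dots> \<le> sqrt_iter_bound n * (sqrt_iter_bound n * norm x)"
    by (intro mult_left_mono Suc sqrt_iter_bound_bounds)
  finally have "norm (B x + sqrt_iter B n (sqrt_iter B n x)) \<le> norm x + (sqrt_iter_bound n)\<^sup>2 * norm x"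
    using assms[of x] by (intro norm_triangle_le) (simp add: power2_eq_square)
  then show ?case
    by (simp add: distrib_right)
qed simp

lemma norm_sqrt_iter_Suc_diff_le:
  assumes B: "bounded_clinear B" "\<And>x. norm (B x) \<le> norm x"
  shows "norm (sqrt_iter B (Suc n) x - sqrt_iter B n x)
    \<le> (sqrt_iter_bound (Suc n) - sqrt_iter_bound n) * norm x"
proof (induction n arbitrary: x)
  case 0
  then show ?case using B(2)[of x] by simp
next
  case (Suc n)
  define Y Z y z where "Y = sqrt_iter B n" and "Z = sqrt_iter B (Suc n)"
    and "y = sqrt_iter_bound n" and "z = sqrt_iter_bound (Suc n)"
  interpret Z: bounded_linear Z
    unfolding Z_def using B(1) by (intro bounded_clinear_linear bounded_clinear_sqrt_iter)
  have diff: "norm (Z x - Y x) \<le> (z - y) * norm x" for x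
    unfolding Y_def Z_def y_def z_def by (rule Suc)
  have "0 \<le> y" "y \<le> z"
    unfolding y_def z_def by (rule sqrt_iter_bound_bounds sqrt_iter_bound_le_Suc)+
  have "norm (Z (Z x - Y x)) \<le> z * norm (Z x - Y x)"
    unfolding z_def Z_def using B(2) by (rule norm_sqrt_iter_le)
  also have "\<dots> \<le> z * ((z - y) * norm x)"
    using \<open>0 \<le> y\<close> \<open>y \<le> z\<close> by (intro mult_left_mono diff) auto
  finally have 1: "norm (Z (Z x - Y x)) \<le> z * ((z - y) * norm x)" .
  have "norm (Z (Y x) - Y (Y x)) \<le> (z - y) * norm (Y x)"
    by (rule diff)
  also have "\<dots> \<le> (z - y) * (y * norm x)"
    unfolding y_def Y_def using \<open>y \<le> z\<close> B(2)
    by (intro mult_left_mono norm_sqrt_iter_le) (auto simp: y_def)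
  finally have 2: "norm (Z (Y x) - Y (Y x)) \<le> (z - y) * (y * norm x)" .
  have "sqrt_iter B (Suc (Suc n)) x - sqrt_iter B (Suc n) x
      = (1/2) *\<^sub>R (B x + Z (Z x)) - (1/2) *\<^sub>R (B x + Y (Y x))"
    by (simp add: Y_def Z_def)
  \<comment> \<open>The splitting \<open>Z Z - Y Y = Z (Z - Y) + (Z - Y) Y\<close> yields the factor
    \<open>(z - y) * (z + y)\<close>, twice the next scalar increment.\<close>
  also have "\<dots> = (1/2) *\<^sub>R (Z (Z x - Y x) + (Z (Y x) - Y (Y x)))"
    by (simp add: Z.diff algebra_simps)
  finally have "norm (sqrt_iter B (Suc (Suc n)) x - sqrt_iter B (Suc n) x)
      \<le> (z * ((z - y) * norm x) + (z - y) * (y * norm x)) / 2"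
    using norm_triangle_mono[OF 1 2] by simp
  also have "\<dots> = (sqrt_iter_bound (Suc (Suc n)) - sqrt_iter_bound (Suc n)) * norm x"
  proof -
    have eq: "sqrt_iter_bound (Suc (Suc n)) - sqrt_iter_bound (Suc n) = (1 + z\<^sup>2) / 2 - (1 + y\<^sup>2) / 2"
      by (simp add: y_def z_def)
    show ?thesis
      unfolding eq by (simp add: power2_eq_square field_simps)
  qed
  finally show ?case .
qed

lemma norm_sqrt_iter_diff_le:
  assumes B: "bounded_clinear B" "\<And>x. norm (B x) \<le> norm x" and "n \<le> m"
  shows "norm (sqrt_iter B m x - sqrt_iter B n x) \<le> (sqrt_iter_bound m - sqrt_iter_bound n) * norm x"
  using \<open>n \<le> m\<close>
proof (induction m rule: dec_induct)
  case (step m)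
  have "norm ((sqrt_iter B (Suc m) x - sqrt_iter B m x) + (sqrt_iter B m x - sqrt_iter B n x))
    \<le> (sqrt_iter_bound (Suc m) - sqrt_iter_bound m) * norm x
      + (sqrt_iter_bound m - sqrt_iter_bound n) * norm x"
    using norm_sqrt_iter_Suc_diff_le[OF B] step.IH by (rule norm_triangle_mono)
  then show ?case
    by (simp add: algebra_simps del: sqrt_iter.simps sqrt_iter_bound.simps)
qed simp

lemma Cauchy_sqrt_iter:
  assumes B: "bounded_clinear B" "\<And>x. norm (B x) \<le> norm x"
  shows "Cauchy (\<lambda>n. sqrt_iter B n x)"
proof (rule CauchyI)
  fix e :: real assume "e > 0"
  \<comment> \<open>Adding 1 keeps the denominator positive when \<open>x = 0\<close>.\<close>
  then have "0 < e / (norm x + 1)"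
    by (simp add: add_nonneg_pos)
  from CauchyD[OF Cauchy_sqrt_iter_bound this] obtain M where
    M: "\<And>m n. m \<ge> M \<Longrightarrow> n \<ge> M \<Longrightarrow> \<bar>sqrt_iter_bound m - sqrt_iter_bound n\<bar> < e / (norm x + 1)"
    by auto
  have *: "norm (sqrt_iter B m x - sqrt_iter B n x) < e" if "n \<ge> M" "n \<le> m" for m n
  proof -
    have "norm (sqrt_iter B m x - sqrt_iter B n x) \<le> (sqrt_iter_bound m - sqrt_iter_bound n) * norm x"
      using B that(2) by (rule norm_sqrt_iter_diff_le)
    also have "\<dots> \<le> e / (norm x + 1) * norm x"
      using M[of m n] that by (intro mult_right_mono) auto
    also have "\<dots> < e / (norm x + 1) * (norm x + 1)"
      using \<open>0 < e / (norm x + 1)\<close> by (intro mult_strict_left_mono) auto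
    also have "\<dots> = e"
      using norm_ge_zero[of x] by (intro nonzero_eq_divide_eq[THEN iffD1, OF _ refl]) linarith
    finally show ?thesis .
  qed
  have "norm (sqrt_iter B m x - sqrt_iter B n x) < e" if "m \<ge> M" "n \<ge> M" for m n
    using *[of n m] *[of m n] that by (cases "n \<le> m") (auto simp: norm_minus_commute)
  then show "\<exists>M. \<forall>m\<ge>M. \<forall>n\<ge>M. norm (sqrt_iter B m x - sqrt_iter B n x) < e"
    by blast
qed

lemma cinner_sqrt_iter:
  assumes "\<And>x y. cinner (B x) y = cinner x (B y)"
  shows "cinner (sqrt_iter B n x) y = cinner x (sqrt_iter B n y)"
  by (induction n arbitrary: x y) (simp_all add: cinner_simps assms)

text \<open>Every iterate is a polynomial in \<open>B\<close>. The commutation passes to the limit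
  and later gives uniqueness of the square root.\<close>

lemma sqrt_iter_commute:
  assumes "bounded_linear C" "\<And>x. C (B x) = B (C x)"
  shows "C (sqrt_iter B n x) = sqrt_iter B n (C x)"
proof -
  interpret C: bounded_linear C by fact
  show ?thesis
    by (induction n arbitrary: x) (simp_all add: C.zero C.scaleR C.add assms(2))
qed

lemma sqrt_one_minus_contraction:
  fixes B :: "'a::complex_hilbert_space \<Rightarrow> 'a"
  assumes B: "bounded_clinear B" "\<And>x. norm (B x) \<le> norm x"
    and sym: "\<And>x y. cinner (B x) y = cinner x (B y)"
  obtains P where "positive_op P" "\<And>x. P (P x) = x - B x"
    "\<And>C x. bounded_linear C \<Longrightarrow> (\<And>x. C (B x) = B (C x)) \<Longrightarrow> C (P x) = P (C x)"
proof -
  define Y where "Y x = lim (\<lambda>n. sqrt_iter B n x)" for x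
  have lim: "(\<lambda>n. sqrt_iter B n x) \<longlonglongrightarrow> Y x" for x
    unfolding Y_def using Cauchy_sqrt_iter[OF B]
    by (simp add: Cauchy_convergent convergent_LIMSEQ_iff[symmetric])
  have iter_lin: "bounded_linear (sqrt_iter B n)" for n
    using B(1) by (intro bounded_clinear_linear bounded_clinear_sqrt_iter)
  have iter_le: "norm (sqrt_iter B n x) \<le> norm x" for n x
    using norm_sqrt_iter_le[of B n x, OF B(2)]
      mult_right_mono[OF sqrt_iter_bound_bounds(2)[of n] norm_ge_zero[of x]] by simp
  have Y_le: "norm (Y x) \<le> norm x" for x
    by (rule LIMSEQ_le_const2[OF tendsto_norm[OF lim]]) (use iter_le in blast)
  have Y_scaleC: "Y (c *\<^sub>C x) = c *\<^sub>C Y x" for c x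
    using lim[of "c *\<^sub>C x"] bounded_linear.tendsto[OF bounded_linear_scaleC lim[of x], of c]
    by (simp add: bounded_clinear_scaleC[OF bounded_clinear_sqrt_iter[OF B(1)]] LIMSEQ_unique)
  have Y: "bounded_clinear Y"
    unfolding bounded_clinear_def
  proof (intro conjI allI Y_scaleC bounded_linear_intro[where K = 1])
    show "Y (x + y) = Y x + Y y" for x y
      using lim[of "x + y"] tendsto_add[OF lim lim, of x y]
      by (simp add: linear_add[OF bounded_linear.linear[OF iter_lin]] LIMSEQ_unique)
    show "Y (r *\<^sub>R x) = r *\<^sub>R Y x" for r x
      using Y_scaleC[of "complex_of_real r"] by (simp add: scaleC_of_real)
  qed (simp add: Y_le)
  \<comment> \<open>Pointwise convergence does not by itself pass to compositions; the uniform bound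
    \<open>iter_le\<close> controls the outer iterate on the vanishing difference.\<close>
  have iter2: "(\<lambda>n. sqrt_iter B n (sqrt_iter B n x)) \<longlonglongrightarrow> Y (Y x)" for x
  proof -
    have "(\<lambda>n. norm (sqrt_iter B n x - Y x)) \<longlonglongrightarrow> 0"
      using lim LIM_zero tendsto_norm_zero by blast
    then have "(\<lambda>n. sqrt_iter B n (sqrt_iter B n x - Y x)) \<longlonglongrightarrow> 0"
      by (rule Lim_null_comparison[rotated]) (simp add: iter_le)
    from tendsto_add[OF this lim[of "Y x"]] show ?thesis
      by (simp add: linear_diff[OF bounded_linear.linear[OF iter_lin]])
  qed
  have fix_eq: "Y x = (1/2) *\<^sub>R (B x + Y (Y x))" for x
  proof (rule LIMSEQ_unique)
    show "(\<lambda>n. sqrt_iter B (Suc n) x) \<longlonglongrightarrow> Y x"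
      using lim by (rule LIMSEQ_Suc)
    show "(\<lambda>n. sqrt_iter B (Suc n) x) \<longlonglongrightarrow> (1/2) *\<^sub>R (B x + Y (Y x))"
      unfolding sqrt_iter.simps by (intro tendsto_intros iter2)
  qed
  have Y_sym: "cinner (Y x) y = cinner x (Y y)" for x y
    using tendsto_cinner[OF lim[of x] tendsto_const[of y]]
      tendsto_cinner[OF tendsto_const[of x] lim[of y]]
    by (simp add: cinner_sqrt_iter[OF sym] LIMSEQ_unique)
  interpret Y: bounded_linear Y
    using Y by (rule bounded_clinear_linear)
  show thesis
  \<comment> \<open>From \<open>2 Y = B + Y\<^sup>2\<close> follows
    \<open>(1 - Y)\<^sup>2 = 1 - B\<close>, and \<open>1 - Y\<close> is positive because
    \<open>Y\<close> is a symmetric contraction.\<close>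
  proof (rule that[of "\<lambda>x. x - Y x"])
    have "inner (Y x) x \<le> inner x x" for x
      using norm_cauchy_schwarz[of "Y x" x] mult_right_mono[OF Y_le[of x] norm_ge_zero[of x]]
      by (simp flip: power2_norm_eq_inner add: power2_eq_square)
    then show "positive_op (\<lambda>x. x - Y x)"
      by (simp add: positive_op_iff bounded_clinear_diff bounded_clinear_ident Y cinner_simps
          Y_sym inner_diff_left)
    show "(x - Y x) - Y (x - Y x) = x - B x" for x
    proof -
      have "Y x + Y x = B x + Y (Y x)"
        using arg_cong[OF fix_eq[of x], of "\<lambda>v. 2 *\<^sub>R v"] by (simp add: scaleR_2)
      then show ?thesis
        by (simp add: Y.diff algebra_simps)
    qed
    show "C (x - Y x) = C x - Y (C x)" if C: "bounded_linear C" "\<And>x. C (B x) = B (C x)" for C x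
    proof -
      have "C (Y x) = Y (C x)"
        using bounded_linear.tendsto[OF C(1) lim[of x]] lim[of "C x"]
        by (simp add: sqrt_iter_commute[where B = B, OF C] LIMSEQ_unique)
      then show ?thesis
        by (simp add: linear_diff[OF bounded_linear.linear[OF C(1)]])
    qed
  qed
qed

lemma positive_sqrt_exists:
  fixes A :: "'a::complex_hilbert_space \<Rightarrow> 'a"
  assumes A: "positive_op A"
  obtains P where "positive_op P" "P \<circ> P = A"
    "\<And>C x. bounded_linear C \<Longrightarrow> (\<And>x. C (A x) = A (C x)) \<Longrightarrow> C (P x) = P (C x)"
proof -
  interpret A: bounded_linear A
    using A by (intro bounded_clinear_linear positive_op_bounded_clinear)
  obtain K where K: "K > 0" "\<And>x. norm (A x) \<le> K * norm x"
    using A.pos_bounded by (metis mult.commute)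
  \<comment> \<open>Scaling by the bound \<open>K\<close> turns \<open>A\<close> into
    \<open>1 - B\<close> with \<open>B\<close> a contraction, as
    \<open>(A / K)\<^sup>2 \<le> A / K\<close>; the root is rescaled by \<open>sqrt K\<close>
    afterwards.\<close>
  define B where "B x = x - (1 / K) *\<^sub>R A x" for x
  have B_le: "norm (B x) \<le> norm x" for x
  proof -
    have "(norm (B x))\<^sup>2 = (norm x)\<^sup>2 - 2 / K * inner (A x) x + (norm (A x))\<^sup>2 / K\<^sup>2"
      unfolding B_def power2_norm_eq_inner
      by (simp add: inner_diff_left inner_diff_right inner_commute power2_eq_square)
    also have "(norm (A x))\<^sup>2 / K\<^sup>2 \<le> K * inner (A x) x / K\<^sup>2"
      by (intro divide_right_mono positive_op_norm_sq_le A K) simp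
    also have "K * inner (A x) x / K\<^sup>2 = 1 / K * inner (A x) x"
      using K(1) by (simp add: power2_eq_square)
    finally have "(norm (B x))\<^sup>2 \<le> (norm x)\<^sup>2 - 1 / K * inner (A x) x"
      by simp
    also have "\<dots> \<le> (norm x)\<^sup>2"
      using K(1) positive_op_nonneg[OF A, of x] by simp
    finally show ?thesis
      by simp
  qed
  have B_lin: "bounded_clinear B"
    unfolding B_def
    by (intro bounded_clinear_diff bounded_clinear_ident bounded_clinear_scaleR
        positive_op_bounded_clinear A)
  have B_sym: "cinner (B x) y = cinner x (B y)" for x y
    by (simp add: B_def cinner_simps positive_op_symmetric[OF A])
  obtain P where P: "positive_op P" "\<And>x. P (P x) = x - B x"
    and comm: "\<And>C x. bounded_linear C \<Longrightarrow> (\<And>x. C (B x) = B (C x)) \<Longrightarrow> C (P x) = P (C x)"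
    using sqrt_one_minus_contraction[OF B_lin B_le B_sym] by blast
  interpret P: bounded_linear P
    using P by (intro bounded_clinear_linear positive_op_bounded_clinear)
  show thesis
  proof (rule that[of "\<lambda>x. sqrt K *\<^sub>R P x"])
    show "positive_op (\<lambda>x. sqrt K *\<^sub>R P x)"
      using P(1) K(1) by (intro positive_op_scaleR) auto
    show "(\<lambda>x. sqrt K *\<^sub>R P x) \<circ> (\<lambda>x. sqrt K *\<^sub>R P x) = A"
      using K(1) by (auto simp: P.scaleR P(2) B_def)
    show "C (sqrt K *\<^sub>R P x) = sqrt K *\<^sub>R P (C x)"
      if C: "bounded_linear C" "\<And>x. C (A x) = A (C x)" for C x
    proof -
      interpret C: bounded_linear C by fact
      have "C (B x) = B (C x)" for x
        by (simp add: B_def C.diff C.scaleR C(2))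
      then show ?thesis
        by (simp add: C.scaleR comm[OF C(1)])
    qed
  qed
qed

text \<open>Uniqueness: a second root \<open>Q\<close> commutes with \<open>A = Q\<^sup>2\<close>,
  hence with \<open>P\<close>, so \<open>(P + Q) (Q - P) = 0\<close>. Positivity makes both summands
  vanish, and symmetry of \<open>Q - P\<close> then gives \<open>Q = P\<close>.\<close>

lemma op_sqrt:
  fixes A :: "'a::complex_hilbert_space \<Rightarrow> 'a"
  assumes A: "positive_op A"
  shows "positive_op (op_sqrt A) \<and> op_sqrt A \<circ> op_sqrt A = A"
proof -
  obtain P where P: "positive_op P" "P \<circ> P = A"
    and comm: "\<And>C x. bounded_linear C \<Longrightarrow> (\<And>x. C (A x) = A (C x)) \<Longrightarrow> C (P x) = P (C x)"
    using positive_sqrt_exists[OF A] by blast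
  interpret P: bounded_linear P
    using P by (intro bounded_clinear_linear positive_op_bounded_clinear)
  have "Q = P" if Q: "positive_op Q" "Q \<circ> Q = A" for Q
  proof
    fix x
    interpret Q: bounded_linear Q
      using Q by (intro bounded_clinear_linear positive_op_bounded_clinear)
    have sq: "P (P v) = Q (Q v)" for v
      using P(2) Q(2) by (metis comp_apply)
    have QP: "Q (P v) = P (Q v)" for v
      by (rule comm[OF Q.bounded_linear_axioms]) (simp flip: Q(2))
    define D where "D v = Q v - P v" for v
    have "P (D x) + Q (D x) = 0"
      by (simp add: D_def P.diff Q.diff sq QP)
    then have "inner (P (D x)) (D x) + inner (Q (D x)) (D x) = 0"
      by (metis inner_add_left inner_zero_left)
    then have "inner (P (D x)) (D x) = 0" "inner (Q (D x)) (D x) = 0"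
      using positive_op_nonneg[OF P(1), of "D x"] positive_op_nonneg[OF Q(1), of "D x"] by linarith+
    then have "P (D x) = 0" "Q (D x) = 0"
      using P(1) Q(1) by (auto intro: positive_op_eq_0)
    then have "cinner (Q x - P x) (D x) = 0"
      by (simp add: cinner_simps positive_op_symmetric[OF P(1)] positive_op_symmetric[OF Q(1)])
    then have "cinner (D x) (D x) = 0"
      by (simp only: D_def)
    then show "Q x = P x"
      by (simp add: cinner_self D_def)
  qed
  with P have "\<exists>!P. positive_op P \<and> P \<circ> P = A"
    by blast
  from theI'[OF this] show ?thesis
    unfolding op_sqrt_def .
qed

lemma op_abs:
  fixes T :: "'a::complex_hilbert_space \<Rightarrow> 'a"
  assumes T: "bounded_clinear T"
  shows positive_op_op_abs: "positive_op (op_abs T)"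
    and cinner_op_abs: "cinner (op_abs T x) (op_abs T y) = cinner (T x) (T y)"
proof -
  have left: "cinner ((adj T \<circ> T) x) y = cinner (T x) (T y)" for x y
    by (metis cinner_adj[OF T] cinner_commute comp_apply)
  have right: "cinner x ((adj T \<circ> T) y) = cinner (T x) (T y)" for x y
    by (simp add: cinner_adj[OF T])
  have "bounded_clinear (adj T \<circ> T)"
    unfolding comp_def by (intro bounded_clinear_compose[OF bounded_clinear_adj] T)
  then have "positive_op (adj T \<circ> T)"
    unfolding positive_op_iff by (simp only: left right inner_eq_Re_cinner Re_cinner_self) simp
  from op_sqrt[OF this] have P: "positive_op (op_abs T)" and sq: "op_abs T \<circ> op_abs T = adj T \<circ> T"
    by (auto simp: op_abs_def)
  show "positive_op (op_abs T)"
    by (rule P)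
  have "cinner (op_abs T x) (op_abs T y) = cinner ((op_abs T \<circ> op_abs T) x) y"
    by (simp only: comp_apply positive_op_symmetric[OF P])
  then show "cinner (op_abs T x) (op_abs T y) = cinner (T x) (T y)"
    by (simp only: sq left)
qed

section \<open>The polar decomposition\<close>

text \<open>Isolates what is used of the absolute value: \<open>A\<close> is positive and
  \<open>A z\<close> goes to \<open>T z\<close> isometrically. The polar factor is the extension of
  this isometry by zero.\<close>

locale polar_pair =
  fixes T A :: "'a::complex_hilbert_space \<Rightarrow> 'a"
  assumes T: "bounded_clinear T" and A: "positive_op A"
    and cinner_A_A: "cinner (A x) (A y) = cinner (T x) (T y)"
begin

sublocale T: bounded_linear T
  using T by (rule bounded_clinear_linear)

sublocale A: bounded_linear A
  using A by (intro bounded_clinear_linear positive_op_bounded_clinear)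

lemma A_scaleC: "A (c *\<^sub>C x) = c *\<^sub>C A x"
  using A by (intro bounded_clinear_scaleC positive_op_bounded_clinear)

lemma norm_A: "norm (A x) = norm (T x)"
proof -
  have "(norm (A x))\<^sup>2 = (norm (T x))\<^sup>2"
    using cinner_A_A[of x x] by (simp only: flip: Re_cinner_self)
  then show ?thesis
    by (simp add: power2_eq_iff_nonneg)
qed

lemma A_eq_0_iff: "A x = 0 \<longleftrightarrow> T x = 0"
  by (metis norm_A norm_eq_zero)

lemma null_space_T: "null_space T = {x. A x = 0}"
  by (simp add: null_space_def A_eq_0_iff)

text \<open>The graph of the polar factor: \<open>p = lim A (s n)\<close> is the component of \<open>x\<close> in the closure of
  the range of \<open>A\<close>, and \<open>x - p\<close> lies in its orthogonal complement, the null space of \<open>A\<close>.\<close>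

definition polar_rel :: "'a \<Rightarrow> 'a \<Rightarrow> bool" where
  "polar_rel x v \<longleftrightarrow>
     (\<exists>s p. (\<lambda>n. A (s n)) \<longlonglongrightarrow> p \<and> (\<lambda>n. T (s n)) \<longlonglongrightarrow> v \<and> A (x - p) = 0)"

lemma polar_relI:
  "(\<lambda>n. A (s n)) \<longlonglongrightarrow> p \<Longrightarrow> (\<lambda>n. T (s n)) \<longlonglongrightarrow> v \<Longrightarrow> A (x - p) = 0 \<Longrightarrow> polar_rel x v"
  unfolding polar_rel_def by blast

lemma polar_relE:
  assumes "polar_rel x v"
  obtains s p where "(\<lambda>n. A (s n)) \<longlonglongrightarrow> p" "(\<lambda>n. T (s n)) \<longlonglongrightarrow> v" "A (x - p) = 0"
  using assms unfolding polar_rel_def by blast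

text \<open>Symmetry of \<open>A\<close> makes its range orthogonal to its null space, and
  continuity extends this to the closure of the range.\<close>

lemma cinner_limit_null:
  assumes "(\<lambda>n. A (s n)) \<longlonglongrightarrow> p" "A y = 0"
  shows "cinner p y = 0"
proof -
  have "(\<lambda>n. cinner (A (s n)) y) \<longlonglongrightarrow> cinner p y"
    using assms(1) by (intro tendsto_cinner tendsto_const)
  moreover have "cinner (A (s n)) y = 0" for n
    using assms(2) by (simp add: positive_op_symmetric[OF A] cinner_simps)
  ultimately show ?thesis
    by (simp add: LIMSEQ_const_iff)
qed

lemma norm_limits_eq:
  assumes "(\<lambda>n. A (s n)) \<longlonglongrightarrow> p" "(\<lambda>n. T (s n)) \<longlonglongrightarrow> v"
  shows "norm v = norm p"
  using tendsto_norm[OF assms(1)] tendsto_norm[OF assms(2)] by (simp add: norm_A LIMSEQ_unique)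

lemma polar_rel_add:
  assumes "polar_rel x v" "polar_rel y w"
  shows "polar_rel (x + y) (v + w)"
proof -
  obtain s p where s: "(\<lambda>n. A (s n)) \<longlonglongrightarrow> p" "(\<lambda>n. T (s n)) \<longlonglongrightarrow> v" "A (x - p) = 0"
    using assms(1) by (rule polar_relE)
  obtain t q where t: "(\<lambda>n. A (t n)) \<longlonglongrightarrow> q" "(\<lambda>n. T (t n)) \<longlonglongrightarrow> w" "A (y - q) = 0"
    using assms(2) by (rule polar_relE)
  show ?thesis
  proof (rule polar_relI)
    show "(\<lambda>n. A (s n + t n)) \<longlonglongrightarrow> p + q" "(\<lambda>n. T (s n + t n)) \<longlonglongrightarrow> v + w"
      using s t by (auto simp: A.add T.add intro!: tendsto_add)
    show "A (x + y - (p + q)) = 0"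
      using s(3) t(3) by (simp add: A.diff A.add)
  qed
qed

lemma polar_rel_scaleC:
  assumes "polar_rel x v"
  shows "polar_rel (c *\<^sub>C x) (c *\<^sub>C v)"
proof -
  note lin = linear_0[OF bounded_linear.linear[OF bounded_linear_scaleC]]
    linear_diff[OF bounded_linear.linear[OF bounded_linear_scaleC]]
  obtain s p where s: "(\<lambda>n. A (s n)) \<longlonglongrightarrow> p" "(\<lambda>n. T (s n)) \<longlonglongrightarrow> v" "A (x - p) = 0"
    using assms by (rule polar_relE)
  show ?thesis
  proof (rule polar_relI)
    show "(\<lambda>n. A (c *\<^sub>C s n)) \<longlonglongrightarrow> c *\<^sub>C p" "(\<lambda>n. T (c *\<^sub>C s n)) \<longlonglongrightarrow> c *\<^sub>C v"
      using s by (simp_all add: A_scaleC bounded_clinear_scaleC[OF T]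
          bounded_linear.tendsto[OF bounded_linear_scaleC])
    have "A (c *\<^sub>C x - c *\<^sub>C p) = c *\<^sub>C A (x - p)"
      by (simp only: lin(2)[symmetric] A_scaleC)
    then show "A (c *\<^sub>C x - c *\<^sub>C p) = 0"
      using s(3) lin(1) by simp
  qed
qed

text \<open>\<open>v\<close> is as long as \<open>p\<close>, an orthogonal projection of
  \<open>x\<close>. The bound also makes the relation single-valued: by linearity two images of
  \<open>x\<close> differ by an image of 0.\<close>

lemma polar_rel_norm_le:
  assumes "polar_rel x v"
  shows "norm v \<le> norm x"
proof -
  obtain s p where s: "(\<lambda>n. A (s n)) \<longlonglongrightarrow> p" "(\<lambda>n. T (s n)) \<longlonglongrightarrow> v" "A (x - p) = 0"
    using assms by (rule polar_relE)
  have "inner p (x - p) = 0"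
    using cinner_limit_null[OF s(1,3)] by (simp add: inner_eq_Re_cinner)
  then have "(norm p)\<^sup>2 \<le> norm p * norm x"
    using norm_cauchy_schwarz[of p x] by (simp add: inner_diff_right power2_norm_eq_inner)
  then have "norm p \<le> norm x"
    by (cases "p = 0") (auto simp: power2_eq_square)
  then show ?thesis
    using norm_limits_eq[OF s(1,2)] by simp
qed

lemma polar_rel_unique:
  assumes "polar_rel x v" "polar_rel x w"
  shows "v = w"
proof -
  have "polar_rel (x + (-1) *\<^sub>C x) (v + (-1) *\<^sub>C w)"
    using assms by (intro polar_rel_add polar_rel_scaleC)
  then have "polar_rel 0 (v - w)"
    using scaleC_of_real[of "-1" x] scaleC_of_real[of "-1" w] by simp
  from polar_rel_norm_le[OF this] show ?thesis
    by simp
qed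

section \<open>The relation is defined everywhere\<close>

lemma subspace_range_A: "subspace (range A)"
  by (rule linear_subspace_image[OF A.linear_axioms subspace_UNIV])

lemma subspace_closure_range_A: "subspace (closure (range A))"
proof (rule subspaceI)
  show "0 \<in> closure (range A)"
    by (metis A.zero closure_subset rangeI subsetD)
next
  fix x y assume "x \<in> closure (range A)" "y \<in> closure (range A)"
  then obtain s t where s: "\<And>n. s n \<in> range A" "s \<longlonglongrightarrow> x" and t: "\<And>n. t n \<in> range A" "t \<longlonglongrightarrow> y"
    unfolding closure_sequential by blast
  have "s n + t n \<in> range A" for n
    using s(1)[of n] t(1)[of n] by (rule subspace_add[OF subspace_range_A])
  with tendsto_add[OF s(2) t(2)] show "x + y \<in> closure (range A)"
    unfolding closure_sequential by (intro exI[of _ "\<lambda>n. s n + t n"]) simp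
next
  fix c :: real and x assume "x \<in> closure (range A)"
  then obtain s where s: "\<And>n. s n \<in> range A" "s \<longlonglongrightarrow> x"
    unfolding closure_sequential by blast
  have "c *\<^sub>R s n \<in> range A" for n
    using s(1)[of n] by (rule subspace_scale[OF subspace_range_A])
  with tendsto_scaleR[OF tendsto_const s(2)] show "c *\<^sub>R x \<in> closure (range A)"
    unfolding closure_sequential by (intro exI[of _ "\<lambda>n. c *\<^sub>R s n"]) simp
qed

lemma polar_rel_total: "\<exists>v. polar_rel x v"
proof -
  obtain p where p: "p \<in> closure (range A)" "\<And>y. y \<in> closure (range A) \<Longrightarrow> inner (x - p) y = 0"
    using orthogonal_projection_exists[OF closed_closure subspace_closure_range_A] by blast
  \<comment> \<open>Orthogonality of \<open>x - p\<close> to the range is applied to the range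
    vector \<open>A (A (x - p))\<close>.\<close>
  have "inner (A (x - p)) (A (x - p)) = inner (x - p) (A (A (x - p)))"
    by (simp add: inner_eq_Re_cinner positive_op_symmetric[OF A])
  also have "\<dots> = 0"
    by (rule p(2)) (rule subsetD[OF closure_subset rangeI])
  finally have null: "A (x - p) = 0"
    by simp
  obtain r where r: "\<And>n. r n \<in> range A" "r \<longlonglongrightarrow> p"
    using p(1) unfolding closure_sequential by blast
  then have "\<forall>n. \<exists>z. r n = A z"
    by auto
  then obtain s where s: "\<And>n. r n = A (s n)"
    by metis
  have lim: "(\<lambda>n. A (s n)) \<longlonglongrightarrow> p"
    using r(2) by (simp add: s[symmetric])
  then have "Cauchy (\<lambda>n. A (s n))"
    by (rule LIMSEQ_imp_Cauchy)
  \<comment> \<open>\<open>T\<close> and \<open>A\<close> have equal norms on differences, so Cauchy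
    sequences transfer.\<close>
  then have "Cauchy (\<lambda>n. T (s n))"
    by (simp add: Cauchy_iff norm_A flip: A.diff T.diff)
  then obtain v where "(\<lambda>n. T (s n)) \<longlonglongrightarrow> v"
    by (meson Cauchy_convergent convergentD)
  with lim null show ?thesis
    by (blast intro: polar_relI)
qed

lemma polar_rel_A: "polar_rel (A z) (T z)"
  by (rule polar_relI[where s = "\<lambda>n. z" and p = "A z"]) (simp_all add: A.zero)

lemma polar_rel_null: "A x = 0 \<Longrightarrow> polar_rel x 0"
  by (rule polar_relI[where s = "\<lambda>n. 0" and p = 0]) (simp_all add: A.zero T.zero)

text \<open>This gives uniqueness of the polar factor: continuity determines \<open>V\<close> on the
  closed range of \<open>A\<close>, and the null space condition determines it on the
  complement.\<close>

lemma polar_factor_imp_polar_rel: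
  assumes V: "partial_isometry V" "null_space V = null_space T" "T = V \<circ> A"
  shows "polar_rel x (V x)"
proof -
  interpret V: bounded_linear V
    using V(1) by (simp add: partial_isometry_def bounded_clinear_def)
  obtain v where v: "polar_rel x v"
    using polar_rel_total by blast
  then obtain s p where s: "(\<lambda>n. A (s n)) \<longlonglongrightarrow> p" "(\<lambda>n. T (s n)) \<longlonglongrightarrow> v" "A (x - p) = 0"
    by (rule polar_relE)
  have "T y = V (A y)" for y
    using V(3) by (metis comp_apply)
  then have "V p = v"
    using V.tendsto[OF s(1)] s(2) by (simp add: LIMSEQ_unique)
  moreover have "V (x - p) = 0"
    using s(3) V(2) null_space_T by (auto simp: null_space_def)
  ultimately show ?thesis
    using v by (simp add: V.diff)
qed

lemma polar_factor_exists:
  obtains V where "partial_isometry V" "null_space V = null_space T" "T = V \<circ> A"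
proof -
  obtain V where rel: "\<And>x. polar_rel x (V x)"
    using polar_rel_total by metis
  have V_eqI: "V x = v" if "polar_rel x v" for x v
    using rel that by (rule polar_rel_unique)
  have V_scaleC: "V (c *\<^sub>C x) = c *\<^sub>C V x" for c x
    by (intro V_eqI polar_rel_scaleC rel)
  have V: "bounded_clinear V"
    unfolding bounded_clinear_def
  proof (intro conjI allI V_scaleC bounded_linear_intro[where K = 1])
    show "V (x + y) = V x + V y" for x y
      by (intro V_eqI polar_rel_add rel)
    show "V (r *\<^sub>R x) = r *\<^sub>R V x" for r x
      using V_scaleC[of "complex_of_real r"] by (simp add: scaleC_of_real)
    show "norm (V x) \<le> norm x * 1" for x
      using polar_rel_norm_le[OF rel] by simp
  qed
  have null: "V x = 0 \<longleftrightarrow> A x = 0" for x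
  proof
    assume "V x = 0"
    with rel[of x] obtain s p where s: "(\<lambda>n. A (s n)) \<longlonglongrightarrow> p" "(\<lambda>n. T (s n)) \<longlonglongrightarrow> 0" "A (x - p) = 0"
      by (metis polar_relE)
    then have "p = 0"
      using norm_limits_eq[OF s(1,2)] by simp
    with s(3) show "A x = 0"
      by simp
  qed (simp add: V_eqI polar_rel_null)
  show thesis
  proof
    show null_V: "null_space V = null_space T"
      by (simp add: null_space_T) (simp add: null_space_def null)
    show "T = V \<circ> A"
      using V_eqI[OF polar_rel_A] by (simp add: fun_eq_iff)
    show "partial_isometry V"
      unfolding partial_isometry_def null_V null_space_T
    proof (intro conjI V allI impI)
      fix x assume x: "\<forall>y\<in>{x. A x = 0}. cinner x y = 0"
      obtain s p where s: "(\<lambda>n. A (s n)) \<longlonglongrightarrow> p" "(\<lambda>n. T (s n)) \<longlonglongrightarrow> V x" "A (x - p) = 0"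
        using rel[of x] by (rule polar_relE)
      \<comment> \<open>Both \<open>x\<close> and \<open>p\<close> are orthogonal to the null space,
        which contains \<open>x - p\<close>.\<close>
      have "cinner (x - p) (x - p) = cinner x (x - p) - cinner p (x - p)"
        by (simp add: cinner_simps)
      also have "\<dots> = 0"
        using x s(3) cinner_limit_null[OF s(1,3)] by simp
      finally have "x = p"
        by (simp add: cinner_self)
      then show "norm (V x) = norm x"
        using norm_limits_eq[OF s(1,2)] by simp
    qed
  qed
qed

text \<open>This is \<open>V\<^sup>* V A = A\<close> for the polar factor \<open>V\<close>, tested against \<open>x\<close>.\<close>

lemma cinner_polar_rel:
  assumes "polar_rel x v"
  shows "cinner (A u) x = cinner (T u) v"
proof -
  obtain s p where s: "(\<lambda>n. A (s n)) \<longlonglongrightarrow> p" "(\<lambda>n. T (s n)) \<longlonglongrightarrow> v" "A (x - p) = 0"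
    using assms by (rule polar_relE)
  have "cinner (A u) (x - p) = 0"
    unfolding positive_op_symmetric[OF A] s(3) by (simp add: cinner_simps)
  then have "cinner (A u) x = cinner (A u) p"
    by (simp add: cinner_simps)
  moreover have "(\<lambda>n. cinner (A u) (A (s n))) \<longlonglongrightarrow> cinner (A u) p"
    using s(1) by (intro tendsto_cinner tendsto_const)
  moreover have "(\<lambda>n. cinner (T u) (T (s n))) \<longlonglongrightarrow> cinner (T u) v"
    using s(2) by (intro tendsto_cinner tendsto_const)
  ultimately show ?thesis
    by (simp add: cinner_A_A LIMSEQ_unique)
qed

end

lemma polar_pair_op_abs: "bounded_clinear T \<Longrightarrow> polar_pair T (op_abs T)"
  by unfold_locales (simp_all add: positive_op_op_abs cinner_op_abs)

lemma polar_factor: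
  fixes T :: "'a::complex_hilbert_space \<Rightarrow> 'a"
  assumes "bounded_clinear T"
  shows "partial_isometry (polar_factor T) \<and> null_space (polar_factor T) = null_space T \<and>
    T = polar_factor T \<circ> op_abs T"
proof -
  interpret polar_pair T "op_abs T"
    using assms by (rule polar_pair_op_abs)
  obtain V where V: "partial_isometry V" "null_space V = null_space T" "T = V \<circ> op_abs T"
    by (rule polar_factor_exists)
  have "W = V" if W: "partial_isometry W" "null_space W = null_space T" "T = W \<circ> op_abs T" for W
    using polar_rel_unique polar_factor_imp_polar_rel[OF V] polar_factor_imp_polar_rel[OF W] by blast
  then have "\<exists>!V. partial_isometry V \<and> null_space V = null_space T \<and> T = V \<circ> op_abs T"
    by (intro ex1I[of _ V] conjI V) (elim conjE)
  from theI'[OF this] show ?thesis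
    unfolding polar_factor_def .
qed

section \<open>The numerical range\<close>

lemma cinner_scaleR_image:
  assumes "bounded_clinear T"
  shows "cinner (T (r *\<^sub>R x)) (r *\<^sub>R x) = complex_of_real (r\<^sup>2) * cinner (T x) x"
  using linear_scale[OF bounded_linear.linear[OF bounded_clinear_linear[OF assms]]]
  by (simp add: cinner_simps scaleR_conv_of_real power2_eq_square)

lemma quotient_in_numerical_range:
  assumes T: "bounded_clinear T" and "x \<noteq> 0"
  shows "cinner (T x) x / complex_of_real ((norm x)\<^sup>2) \<in> numerical_range T"
proof -
  have "cinner (T (sgn x)) (sgn x) = cinner (T x) x / complex_of_real ((norm x)\<^sup>2)"
    unfolding sgn_div_norm cinner_scaleR_image[OF T] by (simp add: field_simps power_divide)
  moreover have "norm (sgn x) = 1"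
    using \<open>x \<noteq> 0\<close> by (simp add: norm_sgn)
  ultimately show ?thesis
    unfolding numerical_range_def by (metis (mono_tags, lifting) mem_Collect_eq)
qed

text \<open>After an affine change the two given values are \<open>0\<close> and \<open>1\<close>. A phase \<open>l\<close> makes the
  quadratic form real on the segment from \<open>x\<close> to \<open>l y\<close>, so that the normalised form takes every
  intermediate value there.\<close>

theorem convex_numerical_range:
  assumes T: "bounded_clinear T"
  shows "convex (numerical_range T)"
  unfolding convex_alt
proof (intro ballI allI impI)
  fix a b and u :: real
  assume ab: "a \<in> numerical_range T" "b \<in> numerical_range T" and u: "0 \<le> u \<and> u \<le> 1"
  interpret T: bounded_linear T
    using T by (rule bounded_clinear_linear)
  obtain x y where x: "norm x = 1" "a = cinner (T x) x" and y: "norm y = 1" "b = cinner (T y) y"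
    using ab by (auto simp: numerical_range_def)
  show "(1 - u) *\<^sub>R a + u *\<^sub>R b \<in> numerical_range T"
  proof (cases "a = b")
    case True
    then show ?thesis
      using ab by (simp flip: scaleR_left_distrib)
  next
    case False
    define s where "s v w = (cinner (T v) w - a * cinner v w) / (b - a)" for v w
    have s_add: "s (v + w) z = s v z + s w z" "s z (v + w) = s z v + s z w" for v w z
      by (simp_all add: s_def T.add cinner_simps add_divide_distrib[symmetric] algebra_simps)
    have s_scaleR: "s (r *\<^sub>R v) w = complex_of_real r * s v w"
      "s v (r *\<^sub>R w) = complex_of_real r * s v w" for r v w
      by (simp_all add: s_def T.scaleR cinner_simps scaleR_conv_of_real algebra_simps)
    have s_scaleC: "s (c *\<^sub>C v) w = c * s v w" "s v (c *\<^sub>C w) = cnj c * s v w" for c v w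
      by (simp_all add: s_def bounded_clinear_scaleC[OF T] cinner_simps algebra_simps)
    have sx: "s x x = 0" and sy: "s y y = 1"
      using False x y by (simp_all add: s_def cinner_self)
    \<comment> \<open>The imaginary part of the cross terms for \<open>l *\<^sub>C y\<close> is that
      of \<open>cnj l * d\<close>, so \<open>l\<close> is the phase of \<open>d\<close>. For
      \<open>d = 0\<close> any phase works, but \<open>sgn 0 = 0\<close> is not one, hence the
      default 1.\<close>
    define d where "d = s x y - cnj (s y x)"
    define l where "l = (if d = 0 then 1 else sgn d)"
    have l: "cmod l = 1"
      by (simp add: l_def norm_sgn)
    have "Im (cnj l * d) = 0"
      by (simp add: l_def sgn_eq complex_mod_mult_cnj mult.commute[of "cnj d"] flip: complex_norm_square)
    then have real: "Im (s x (l *\<^sub>C y) + s (l *\<^sub>C y) x) = 0"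
      by (simp add: s_scaleC d_def algebra_simps)
    define r where "r = Re (s x (l *\<^sub>C y) + s (l *\<^sub>C y) x)"
    have sum_eq: "s x (l *\<^sub>C y) + s (l *\<^sub>C y) x = complex_of_real r"
      using real by (simp add: r_def complex_eq_iff)
    have sly: "s (l *\<^sub>C y) (l *\<^sub>C y) = 1"
      using l complex_norm_square[of l] by (simp add: s_scaleC sy mult.commute)
    define z where "z t = (1 - t) *\<^sub>R x + t *\<^sub>R (l *\<^sub>C y)" for t
    have s_z: "s (z t) (z t) = complex_of_real (t\<^sup>2 + t * (1 - t) * r)" for t
    proof -
      have "s (z t) (z t) = complex_of_real ((1 - t)\<^sup>2) * s x x
          + complex_of_real (t * (1 - t)) * (s x (l *\<^sub>C y) + s (l *\<^sub>C y) x)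
          + complex_of_real (t\<^sup>2) * s (l *\<^sub>C y) (l *\<^sub>C y)"
        unfolding z_def s_add s_scaleR by (simp add: power2_eq_square algebra_simps)
      then show ?thesis
        unfolding sum_eq sx sly by simp
    qed
    \<comment> \<open>Vanishing forces equal norms, so \<open>t = 1/2\<close> and \<open>x\<close>
      is minus \<open>l *\<^sub>C y\<close>; the form would then agree at both, although it is 0 at
      one and 1 at the other.\<close>
    have z0: "z t \<noteq> 0" if t: "0 \<le> t" "t \<le> 1" for t
    proof
      assume "z t = 0"
      then have eq: "(1 - t) *\<^sub>R x = - (t *\<^sub>R (l *\<^sub>C y))"
        by (simp add: z_def add_eq_0_iff2)
      then have "norm ((1 - t) *\<^sub>R x) = norm (t *\<^sub>R (l *\<^sub>C y))"
        by simp
      then have "t = 1/2"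
        using t x(1) y(1) l by (simp add: norm_scaleC)
      with eq have "(1/2) *\<^sub>R x = (1/2) *\<^sub>R ((-1) *\<^sub>R (l *\<^sub>C y))"
        by simp
      then have "x = (-1) *\<^sub>R (l *\<^sub>C y)"
        by (simp only: scaleR_cancel_left) simp
      then have "s x x = s (l *\<^sub>C y) (l *\<^sub>C y)"
        by (simp only: s_scaleR) simp
      then show False
        by (simp add: sx sly)
    qed
    \<comment> \<open>The normalised form along the segment: real, continuous, 0 at the start and 1
      at the end.\<close>
    define g where "g t = (t\<^sup>2 + t * (1 - t) * r) / (norm (z t))\<^sup>2" for t
    have "continuous_on {0..1} g"
      unfolding g_def using z0 by (auto simp: z_def intro!: continuous_intros)
    moreover have "g 0 \<le> u" "u \<le> g 1"
      using u x(1) y(1) l by (simp_all add: g_def z_def norm_scaleC)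
    ultimately obtain t where t: "0 \<le> t" "t \<le> 1" "g t = u"
      using IVT'[of g 0 u 1] by auto
    have nz: "complex_of_real ((norm (z t))\<^sup>2) \<noteq> 0"
      using z0[OF t(1,2)] by simp
    have "s (z t) (z t) = complex_of_real (g t * (norm (z t))\<^sup>2)"
      using z0[OF t(1,2)] by (simp add: s_z g_def)
    then have "cinner (T (z t)) (z t) - a * complex_of_real ((norm (z t))\<^sup>2)
        = (b - a) * (complex_of_real u * complex_of_real ((norm (z t))\<^sup>2))"
      using False t(3) by (simp add: s_def cinner_self field_simps)
    then have "cinner (T (z t)) (z t)
        = (a + (b - a) * complex_of_real u) * complex_of_real ((norm (z t))\<^sup>2)"
      by (simp add: algebra_simps)
    then have "cinner (T (z t)) (z t) / complex_of_real ((norm (z t))\<^sup>2)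
        = a + (b - a) * complex_of_real u"
      by (simp only: nonzero_divide_eq_eq[OF nz])
    also have "\<dots> = (1 - u) *\<^sub>R a + u *\<^sub>R b"
      by (simp add: scaleR_conv_of_real algebra_simps)
    finally show ?thesis
      using quotient_in_numerical_range[OF T z0[OF t(1,2)]] by simp
  qed
qed

text \<open>Supplies the upper bound without which comparing real suprema would be
  meaningless.\<close>

lemma norm_numerical_range_le:
  assumes "bounded_clinear T"
  obtains K where "\<And>z. z \<in> numerical_range T \<Longrightarrow> cmod z \<le> K"
proof -
  obtain K where K: "\<And>x. norm (T x) \<le> norm x * K"
    using bounded_linear.pos_bounded[OF bounded_clinear_linear[OF assms]] by blast
  have "cmod (cinner (T x) x) \<le> K" if "norm x = 1" for x
    using cmod_cinner_le[of "T x" x] K[of x] that by simp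
  then show thesis
    using that by (auto simp: numerical_range_def)
qed

lemma cinner_mean_transform:
  fixes T :: "'a::complex_hilbert_space \<Rightarrow> 'a"
  assumes T: "bounded_clinear T"
  shows "cinner (mean_transform T x) x =
    (1/2) *\<^sub>R cinner (T x) x + (1/2) *\<^sub>R cinner (T (polar_factor T x)) (polar_factor T x)"
proof -
  interpret polar_pair T "op_abs T"
    using T by (rule polar_pair_op_abs)
  note V = polar_factor[OF T]
  have "polar_factor T (op_abs T x) = T x"
    using V by (metis comp_apply)
  \<comment> \<open>The identity \<open>V\<^sup>* V A = A\<close> is used at the vector
    \<open>V x\<close>, tested against \<open>x\<close>.\<close>
  moreover have "cinner (op_abs T (polar_factor T x)) x
      = cinner (T (polar_factor T x)) (polar_factor T x)"
    using V by (intro cinner_polar_rel polar_factor_imp_polar_rel) auto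
  ultimately show ?thesis
    by (simp add: mean_transform_def cinner_simps scaleR_add_right)
qed

text \<open>Compressing by the polar factor shrinks norms only if \<open>T\<close> has a kernel, and then \<open>0\<close> is in
  the convex set \<open>numerical_range T\<close>.\<close>

lemma cinner_polar_factor_in_numerical_range:
  fixes T :: "'a::complex_hilbert_space \<Rightarrow> 'a"
  assumes T: "bounded_clinear T" and x: "norm x = 1"
  shows "cinner (T (polar_factor T x)) (polar_factor T x) \<in> numerical_range T"
proof -
  interpret polar_pair T "op_abs T"
    using T by (rule polar_pair_op_abs)
  define v where "v = polar_factor T x"
  have V: "partial_isometry (polar_factor T)" "null_space (polar_factor T) = null_space T"
    "T = polar_factor T \<circ> op_abs T"
    using polar_factor[OF T] by auto
  show ?thesis
  proof (cases "null_space T \<subseteq> {0}")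
    case True
    then have "\<forall>y\<in>null_space (polar_factor T). cinner x y = 0"
      using V(2) by (auto simp: cinner_simps)
    then have "norm (polar_factor T x) = norm x"
      using V(1) unfolding partial_isometry_def by blast
    then show ?thesis
      using x by (auto simp: numerical_range_def)
  next
    case False
    then obtain y where "y \<noteq> 0" "T y = 0"
      by (auto simp: null_space_def)
    then have zero: "0 \<in> numerical_range T"
      using quotient_in_numerical_range[OF T, of y] by (simp add: cinner_simps)
    have "norm v \<le> 1"
      using polar_rel_norm_le[OF polar_factor_imp_polar_rel[OF V]] x by (metis v_def)
    have "cinner (T v) v \<in> numerical_range T"
    proof (cases "v = 0")
      case True
      with zero show ?thesis by (simp add: cinner_simps)
    next
      case False
      \<comment> \<open>The weight of the normalised value is the squared norm of \<open>v\<close>,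
        so it cancels the denominator; the remaining weight sits on 0.\<close>
      have "(1 - (norm v)\<^sup>2) *\<^sub>R 0 + (norm v)\<^sup>2 *\<^sub>R (cinner (T v) v / complex_of_real ((norm v)\<^sup>2))
          \<in> numerical_range T"
        using \<open>norm v \<le> 1\<close>
        by (intro convexD_alt[OF convex_numerical_range[OF T] zero
              quotient_in_numerical_range[OF T False]]) (simp_all add: power_le_one)
      then show ?thesis
        using False by (simp add: scaleR_conv_of_real)
    qed
    then show ?thesis
      by (simp add: v_def)
  qed
qed

lemma numerical_range_mean_transform_subset:
  fixes T :: "'a::complex_hilbert_space \<Rightarrow> 'a"
  assumes T: "bounded_clinear T"
  shows "numerical_range (mean_transform T) \<subseteq> numerical_range T"
proof
  fix c assume "c \<in> numerical_range (mean_transform T)"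
  then obtain x where x: "norm x = 1" "c = cinner (mean_transform T x) x"
    by (auto simp: numerical_range_def)
  have "cinner (T x) x \<in> numerical_range T"
    using x(1) by (auto simp: numerical_range_def)
  from convexD_alt[OF convex_numerical_range[OF T] this
      cinner_polar_factor_in_numerical_range[OF T x(1)], of "1/2"]
  show "c \<in> numerical_range T"
    by (simp add: x(2) cinner_mean_transform[OF T])
qed

theorem theorem3p1:
  fixes T :: "'a::complex_hilbert_space \<Rightarrow> 'a"
  assumes "bounded_clinear T"
  shows "closure (numerical_range (mean_transform T)) \<subseteq> closure (numerical_range T)
    \<and> numerical_radius (mean_transform T) \<le> numerical_radius T"
proof
  note sub = numerical_range_mean_transform_subset[OF assms]
  then show "closure (numerical_range (mean_transform T)) \<subseteq> closure (numerical_range T)"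
    by (rule closure_mono)
  show "numerical_radius (mean_transform T) \<le> numerical_radius T"
  \<comment> \<open>Monotonicity of suprema needs a nonempty smaller set. Emptiness means that there
    are no unit vectors, so both radii are the same unspecified value.\<close>
  proof (cases "numerical_range (mean_transform T) = {}")
    case True
    then have "numerical_range T = {}"
      by (auto simp: numerical_range_def)
    with True show ?thesis
      by (simp add: numerical_radius_def)
  next
    case False
    obtain K where "\<And>z. z \<in> numerical_range T \<Longrightarrow> cmod z \<le> K"
      using norm_numerical_range_le[OF assms] by blast
    then have "bdd_above (cmod ` numerical_range T)"
      by (auto intro!: bdd_aboveI)
    then show ?thesis
      unfolding numerical_radius_def using False sub by (intro cSUP_subset_mono) auto
  qed
qed

end
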